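(* There exists a Parry numeration system $U$ such that the class of $U$-automatic sequences is not closed under taking images by uniform substitutions; that is, there exist a Parry numeration system $U$, finite alphabets $A$ and $B$, a $U$-automatic infinite word $\mathbf{x}\in A^{\omega}$, an integer $\ell\ge1$ and a substitution $\mu\colon A\to B^*$ of constant length $\ell$ (i.e., $|\mu(a)|=\ell$ for all $a\in A$) such that the infinite word $\mu(\mathbf{x})=\mu(x_0)\mu(x_1)\mu(x_2)\cdots$ is not $U$-automatic.
   Context: Numeration systems. A (positional) numeration system is an increasing sequence $U=(U_n)_{n\ge 0}$ of integers with $U_0=1$ and $C_U:=\sup_{n\ge 0}\lceil U_{n+1}/U_n\rceil<+\infty$. Put $A_U=\{0,\ldots,C_U-1\}$. The greedy representation of a positive integer $n$ is the word $\mathrm{rep}_U(n)=w_{\ell-1}\cdots w_0$ over $A_U$ with $\sum_{i=0}^{\ell-1}w_iU_i=n$, $w_{\ell-1}\neq 0$ and $\sum_{i=0}^{j-1}w_iU_i<U_j$ for all $j\in\{1,\ldots,\ell\}$; $\mathrm{rep}_U(0)=\varepsilon$ is the empty word. Parry numeration systems. Let $\beta>1$ be real. The $\beta$-expansion of $x\in[0,1]$ is the lexicographically greatest sequence $d_\beta(x)=(x_i)_{i\ge1}$ of nonnegative integers with $x=\sum_{i\ge1}x_i\beta^{-i}$. If $d_\beta(1)=t_1\cdots t_m0^\omega$ with $t_m\neq0$, set $d_\beta^*(1)=(t_1\cdots t_{m-1}(t_m-1))^\omega$; otherwise set $d_\beta^*(1)=d_\beta(1)$. The number $\beta$ is a Parry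 number if $d^*_\beta(1)$ is ultimately periodic. Writing $d_\beta^*(1)=(t_i)_{i\ge1}$, the numeration system $U_\beta=(U_n)_{n\ge0}$ canonically associated with $\beta$ is given by $U_n=t_1U_{n-1}+\cdots+t_nU_0+1$ for all $n\ge0$. A Parry numeration system is a numeration system $U$ with $U=U_\beta$ for some Parry number $\beta$. Automatic sequences. An infinite word $\mathbf{x}=(x_n)_{n\ge0}$ over a finite alphabet $B$ is $U$-automatic if there is a complete deterministic finite automaton with output $(Q,q_0,A_U,\delta,\tau)$, with transition function $\delta\colon Q\times A_U\to Q$ (extended to words, read from left to right, most significant digit first) and output function $\tau\colon Q\to B$, such that $\delta(q_0,0)=q_0$ and $x_n=\tau(\delta(q_0,\mathrm{rep}_U(n)))$ for all $n\ge0$. *)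

theory Defs
  imports Complex_Main "HOL-Library.Stream"
begin

section \<open>Numeration systems\<close>

definition numeration_system :: "(nat \<Rightarrow> nat) \<Rightarrow> bool" where
  "numeration_system U \<longleftrightarrow>
     strict_mono U \<and> U 0 = 1 \<and>
     bdd_above (range (\<lambda>n. nat \<lceil>real (U (Suc n)) / real (U n)\<rceil>))"

definition C_of :: "(nat \<Rightarrow> nat) \<Rightarrow> nat" where
  "C_of U = (SUP n. nat \<lceil>real (U (Suc n)) / real (U n)\<rceil>)"

definition alphabet :: "(nat \<Rightarrow> nat) \<Rightarrow> nat set" where
  "alphabet U = {..<C_of U}"

text \<open>Words are lists with the most significant digit first, so the digit of weight
  \<open>U i\<close> is \<open>rev w ! i\<close>.\<close>

definition greedy_rep :: "(nat \<Rightarrow> nat) \<Rightarrow> nat \<Rightarrow> nat list \<Rightarrow> bool" where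
  "greedy_rep U n w \<longleftrightarrow>
     w \<in> lists (alphabet U) \<and> w \<noteq> [] \<and> hd w \<noteq> 0 \<and>
     (\<Sum>i<length w. rev w ! i * U i) = n \<and>
     (\<forall>j\<in>{1..length w}. (\<Sum>i<j. rev w ! i * U i) < U j)"

definition rep :: "(nat \<Rightarrow> nat) \<Rightarrow> nat \<Rightarrow> nat list" where
  "rep U n = (if n = 0 then [] else THE w. greedy_rep U n w)"


section \<open>Parry numeration systems\<close>

text \<open>Digit sequences \<open>(x\<^sub>i)\<close> with \<open>i \<ge> 1\<close> are functions indexed from 0: the value at \<open>i\<close> is
  \<open>x\<^sub>i\<^sub>+\<^sub>1\<close>.\<close>

definition beta_rep :: "real \<Rightarrow> real \<Rightarrow> (nat \<Rightarrow> nat) \<Rightarrow> bool" where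
  "beta_rep \<beta> x d \<longleftrightarrow> (\<lambda>i. real (d i) / \<beta> ^ Suc i) sums x"

definition lex_less :: "(nat \<Rightarrow> nat) \<Rightarrow> (nat \<Rightarrow> nat) \<Rightarrow> bool" where
  "lex_less d e \<longleftrightarrow> (\<exists>k. (\<forall>i<k. d i = e i) \<and> d k < e k)"

definition beta_expansion :: "real \<Rightarrow> real \<Rightarrow> nat \<Rightarrow> nat" where
  "beta_expansion \<beta> x =
     (THE d. beta_rep \<beta> x d \<and> (\<forall>e. beta_rep \<beta> x e \<longrightarrow> e = d \<or> lex_less e d))"

definition finite_length :: "(nat \<Rightarrow> nat) \<Rightarrow> nat \<Rightarrow> bool" where
  "finite_length t m \<longleftrightarrow> m \<ge> 1 \<and> t (m - 1) \<noteq> 0 \<and> (\<forall>i\<ge>m. t i = 0)"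

definition quasi_greedy_expansion :: "real \<Rightarrow> nat \<Rightarrow> nat" where
  "quasi_greedy_expansion \<beta> =
     (let t = beta_expansion \<beta> 1 in
      if \<exists>m. finite_length t m
      then let m = (THE m. finite_length t m)
           in (\<lambda>i. if i mod m = m - 1 then t (m - 1) - 1 else t (i mod m))
      else t)"

definition ultimately_periodic :: "(nat \<Rightarrow> 'a) \<Rightarrow> bool" where
  "ultimately_periodic t \<longleftrightarrow> (\<exists>N. \<exists>p\<ge>1. \<forall>i\<ge>N. t (i + p) = t i)"

definition Parry_number :: "real \<Rightarrow> bool" where
  "Parry_number \<beta> \<longleftrightarrow> \<beta> > 1 \<and> ultimately_periodic (quasi_greedy_expansion \<beta>)"

fun canonical_system :: "real \<Rightarrow> nat \<Rightarrow> nat" where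
  "canonical_system \<beta> n =
     (\<Sum>i<n. quasi_greedy_expansion \<beta> i * canonical_system \<beta> (n - Suc i)) + 1"

declare canonical_system.simps [simp del]

definition Parry_numeration_system :: "(nat \<Rightarrow> nat) \<Rightarrow> bool" where
  "Parry_numeration_system U \<longleftrightarrow>
     numeration_system U \<and> (\<exists>\<beta>. Parry_number \<beta> \<and> U = canonical_system \<beta>)"


section \<open>Automatic sequences\<close>

record ('q, 'b) dfao =
  states :: "'q set"
  init :: 'q
  trans :: "'q \<Rightarrow> nat \<Rightarrow> 'q"
  outp :: "'q \<Rightarrow> 'b"

definition complete_dfao :: "nat set \<Rightarrow> 'b set \<Rightarrow> ('q, 'b) dfao \<Rightarrow> bool" where
  "complete_dfao \<Sigma> B M \<longleftrightarrow>
     finite (states M) \<and> init M \<in> states M \<and>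
     (\<forall>q\<in>states M. \<forall>a\<in>\<Sigma>. trans M q a \<in> states M) \<and>
     (\<forall>q\<in>states M. outp M q \<in> B)"

text \<open>A finite state set can always be renamed to a set of natural numbers, so the state type is
  fixed to \<^typ>\<open>nat\<close> to allow the existential quantification over automata.\<close>

definition automatic :: "(nat \<Rightarrow> nat) \<Rightarrow> 'b set \<Rightarrow> 'b stream \<Rightarrow> bool" where
  "automatic U B x \<longleftrightarrow>
     (\<exists>M :: (nat, 'b) dfao.
        complete_dfao (alphabet U) B M \<and>
        trans M (init M) 0 = init M \<and>
        (\<forall>n. x !! n = outp M (foldl (trans M) (init M) (rep U n))))"

text \<open>The image of an infinite word under a substitution without empty images;
  \<^const>\<open>flat\<close> concatenates a stream of nonempty lists.\<close>

definition subst_image :: "('a \<Rightarrow> 'b list) \<Rightarrow> 'a stream \<Rightarrow> 'b stream" where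
  "subst_image \<mu> x = flat (smap \<mu> x)"

end

theory Submission imports Defs begin

text \<open>Take \<open>U\<^sub>n\<^sub>+\<^sub>3 = U\<^sub>n\<^sub>+\<^sub>2 + 2 U\<^sub>n\<^sub>+\<^sub>1 - U\<^sub>n\<close> with initial values 1, 2, 4, which comes from the root
  \<open>\<beta> = 1.80\<dots>\<close> of \<open>x\<^sup>3 - x\<^sup>2 - 2 x + 1\<close> and has \<open>11(01)\<^sup>\<omega>\<close> as quasi-greedy expansion of 1. This polynomial
  has another root \<open>\<gamma> = - 1.24\<dots>\<close> outside the unit disc, so \<open>\<beta>\<close> is not Pisot. The characteristic word of
  \<open>{U\<^sub>n}\<close> is automatic, and the substitution \<open>a \<mapsto> a0\<close> turns it into the characteristic word of \<open>{2 U\<^sub>n}\<close>.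
  If the latter were automatic, pumping the greedy representation of some \<open>2 U\<^sub>n\<close> would yield greedy
  representations \<open>u v\<^sup>i z\<close> of numbers \<open>2 U\<^sub>k\<close> for all \<open>i\<close>. Comparing the coefficients of \<open>\<gamma>\<^sup>i\<close> shows that
  the digit sequence \<open>u v\<^sup>\<omega>\<close>, read in base \<open>\<gamma>\<close>, also represents 2. But its leading digit 1 contributes
  the negative number \<open>\<gamma>\<close>, and the remaining digits are too small to compensate for it.\<close>


section \<open>Values of words\<close>

text \<open>The weights are a parameter, so that one word can be evaluated both in \<open>V\<close>
  and at the powers of a root of the characteristic polynomial.\<close>

primrec wval :: "(nat \<Rightarrow> 'a::comm_semiring_1) \<Rightarrow> nat list \<Rightarrow> 'a" where
  "wval f [] = 0"
| "wval f (d # w) = of_nat d * f (length w) + wval f w"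

text \<open>Words start with the most significant digit, so the lowest \<open>j\<close> digits form
  a suffix. This turns the indexed sums of \<open>greedy_rep\<close> into recursion on
  lists.\<close>

lemma wval_drop:
  "j \<le> length w \<Longrightarrow> (\<Sum>i<j. rev w ! i * U i) = wval U (drop (length w - j) w)"
proof (induction w arbitrary: j)
  case (Cons d w)
  show ?case
  proof (cases "j = Suc (length w)")
    case True
    have "(\<Sum>i<j. rev (d # w) ! i * U i) = (\<Sum>i<length w. rev w ! i * U i) + d * U (length w)"
      unfolding True by (simp add: nth_append)
    then show ?thesis using True Cons.IH[of "length w"] Cons by auto
  next
    case False
    then have j: "j \<le> length w" using Cons.prems by simp
    have "(\<Sum>i<j. rev (d # w) ! i * U i) = (\<Sum>i<j. rev w ! i * U i)"
      using j by (intro sum.cong) (auto simp: nth_append)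
    then show ?thesis using Cons.IH[OF j] j by (simp add: Suc_diff_le)
  qed
qed simp

lemma wval_power_append:
  "wval ((^) x) (u @ v) = x ^ length v * wval ((^) x) u + wval ((^) x) v"
  by (induction u) (simp_all add: algebra_simps power_add)

text \<open>A geometric sum with ratio \<open>x ^ length v\<close>, multiplied out to avoid
  division.\<close>

lemma wval_power_concat_replicate:
  fixes x :: "'a::comm_ring_1"
  shows "wval ((^) x) (concat (replicate i v)) * (x ^ length v - 1)
     = wval ((^) x) v * ((x ^ length v) ^ i - 1)"
proof (induction i)
  case (Suc i)
  have "length (concat (replicate i v)) = length v * i" by (induction i) auto
  then have "wval ((^) x) (concat (replicate (Suc i) v))
      = (x ^ length v) ^ i * wval ((^) x) v + wval ((^) x) (concat (replicate i v))"
    by (simp add: wval_power_append power_mult)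
  then show ?case using Suc by (simp add: algebra_simps)
qed simp

lemma wval_replicate_0: "wval f (replicate n 0) = 0"
  by (induction n) auto


section \<open>The sequence\<close>

fun V :: "nat \<Rightarrow> nat" where
  "V 0 = 1"
| "V (Suc 0) = 2"
| "V (Suc (Suc 0)) = 4"
| "V (Suc (Suc (Suc n))) = V (Suc (Suc n)) + 2 * V (Suc n) - V n"

text \<open>One joint induction: the convexity conjunct
  \<open>2 * V (Suc n) \<le> V (Suc (Suc n)) + V n\<close> is what carries the doubling bound
  \<open>V (Suc n) \<le> 2 * V n\<close> to the next index.\<close>

lemma V_growth:
  "V n < V (Suc n) \<and> V (Suc n) \<le> 2 * V n \<and> V (Suc n) < V (Suc (Suc n)) \<and>
   V (Suc (Suc n)) \<le> 2 * V (Suc n) \<and> V n + V (Suc n) \<le> V (Suc (Suc n)) \<and>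
   2 * V (Suc n) \<le> V (Suc (Suc n)) + V n \<and>
   2 * V n < V (Suc (Suc n))"
  by (induction n) (simp, simp, linarith)

text \<open>By the growth bounds, the natural subtraction in the recursion is never
  truncated.\<close>

lemma V_rec: "V (Suc (Suc (Suc n))) + V n = V (Suc (Suc n)) + 2 * V (Suc n)"
  using V_growth[of n] by simp

lemma V_less_Suc: "V n < V (Suc n)"
  and V_Suc_le: "V (Suc n) \<le> 2 * V n"
  and double_V_less: "2 * V n < V (Suc (Suc n))"
  using V_growth[of n] by auto

lemma strict_mono_V: "strict_mono V"
  by (simp add: strict_mono_Suc_iff V_less_Suc)

lemma V_pos: "V n > 0"
  using strict_mono_imp_increasing[OF strict_mono_V, of n] V_less_Suc[of 0]
    strict_mono_less_eq[OF strict_mono_V, of 0 n] by simp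

lemma V_ceiling: "nat \<lceil>real (V (Suc n)) / real (V n)\<rceil> = 2"
proof -
  have "\<lceil>real (V (Suc n)) / real (V n)\<rceil> = 2"
    using V_pos[of n] V_less_Suc[of n] V_Suc_le[of n]
    by (intro ceiling_unique) (simp_all add: field_simps flip: of_nat_mult)
  then show ?thesis by simp
qed

lemma numeration_system_V: "numeration_system V"
  unfolding numeration_system_def using strict_mono_V by (simp only: V_ceiling) simp

lemma alphabet_V: "alphabet V = {0, 1}"
  unfolding alphabet_def C_of_def by (simp only: V_ceiling) auto


section \<open>Greedy representations\<close>

text \<open>Leading zeros are allowed, so that suffixes of greedy words are greedy. The digit bound
  is not imposed; it follows from the inequalities (\<open>greedy_binary\<close>).\<close>

primrec greedy :: "nat list \<Rightarrow> bool" where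
  "greedy [] \<longleftrightarrow> True"
| "greedy (d # w) \<longleftrightarrow> wval V (d # w) < V (Suc (length w)) \<and> greedy w"

lemma greedy_iff_drop:
  "greedy w \<longleftrightarrow> (\<forall>j\<in>{1..length w}. wval V (drop (length w - j) w) < V j)"
proof (induction w)
  case (Cons d w)
  have *: "{1..length (d # w)} = insert (Suc (length w)) {1..length w}" by auto
  show ?case unfolding * using Cons by (auto simp: Suc_diff_le)
qed simp

lemma greedy_less: "greedy w \<Longrightarrow> wval V w < V (length w)"
  by (cases w) auto

lemma greedy_binary: "greedy w \<Longrightarrow> set w \<subseteq> {0, 1}"
proof (induction w)
  case (Cons d w)
  have "d \<le> 1"
  proof (rule ccontr)
    assume "\<not> d \<le> 1"
    then have "2 * V (length w) \<le> d * V (length w)" by (intro mult_right_mono) auto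
    moreover have "d * V (length w) + wval V w < V (Suc (length w))" using Cons.prems by simp
    ultimately show False using V_Suc_le[of "length w"] by linarith
  qed
  then show ?case using Cons by auto
qed simp

lemma greedy_rep_iff:
  "greedy_rep V n w \<longleftrightarrow> w \<noteq> [] \<and> hd w \<noteq> 0 \<and> greedy w \<and> wval V w = n"
proof -
  have "(\<forall>j\<in>{1..length w}. (\<Sum>i<j. rev w ! i * V i) < V j) \<longleftrightarrow> greedy w"
    unfolding greedy_iff_drop by (intro ball_cong) (auto simp: wval_drop)
  then show ?thesis
    unfolding greedy_rep_def alphabet_V using greedy_binary[of w] wval_drop[of "length w" w V]
    by (auto simp: lists_eq_set)
qed

text \<open>The tail of a greedy word is smaller than the weight of the leading digit, so Euclidean
  division recovers that digit.\<close>

lemma greedy_inj: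
  "greedy v \<Longrightarrow> greedy w \<Longrightarrow> length v = length w \<Longrightarrow> wval V v = wval V w \<Longrightarrow> v = w"
proof (induction v arbitrary: w)
  case (Cons d v)
  then obtain e w' where w: "w = e # w'" by (cases w) auto
  have "wval V v < V (length v)" "wval V w' < V (length v)"
    using Cons.prems greedy_less[of v] greedy_less[of w'] by (auto simp: w)
  moreover have "d * V (length v) + wval V v = e * V (length v) + wval V w'"
    using Cons.prems by (simp add: w)
  moreover have "(c * V (length v) + r) div V (length v) = c" if "r < V (length v)" for c r
    using that by (simp add: div_add1_eq)
  ultimately have "d = e" by metis
  moreover have "v = w'" using Cons.prems \<open>d = e\<close> by (intro Cons.IH) (auto simp: w)
  ultimately show ?case by (simp add: w)
qed simp

text \<open>A nonzero leading digit places the value of a greedy word between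
  \<open>V (length w - 1)\<close> and \<open>V (length w)\<close>; such intervals are
  disjoint.\<close>

lemma greedy_length:
  assumes "greedy w" "w \<noteq> []" "hd w \<noteq> 0" "V k \<le> wval V w" "wval V w < V (Suc k)"
  shows "length w = Suc k"
proof -
  obtain d w' where w: "w = d # w'" using assms by (cases w) auto
  have "V (length w') \<le> wval V w"
    using assms(3) by (cases d) (auto simp: w)
  then have "V (length w') < V (Suc k)" "V k < V (length w)"
    using assms greedy_less[of w] by auto
  then show ?thesis using strict_mono_less[OF strict_mono_V] by (auto simp: w)
qed

lemma V_bracket:
  assumes "n > 0"
  obtains k where "V k \<le> n" "n < V (Suc k)"
proof -
  have ex: "n < V (Suc n)"
    using strict_mono_imp_increasing[OF strict_mono_V, of "Suc n"] by simp
  define k where "k = (LEAST k. n < V (Suc k))"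
  have 1: "n < V (Suc k)" unfolding k_def by (rule LeastI) (rule ex)
  have "V k \<le> n"
  proof (cases k)
    case (Suc m)
    then have "\<not> n < V (Suc m)" using not_less_Least[of m "\<lambda>k. n < V (Suc k)"] unfolding k_def by auto
    then show ?thesis using Suc by simp
  qed (use assms in simp)
  with 1 that show ?thesis by blast
qed

lemma greedy_exists: "n < V L \<Longrightarrow> \<exists>w. length w = L \<and> greedy w \<and> wval V w = n"
proof (induction L arbitrary: n)
  case 0
  then show ?case by (intro exI[of _ "[]"]) auto
next
  case (Suc L)
  \<comment> \<open>Subtracting \<open>V L\<close> at most once suffices because
    \<open>V (Suc L) \<le> 2 * V L\<close>.\<close>
  define d where "d = (if n < V L then 0 else 1 :: nat)"
  have "n - d * V L < V L" using Suc.prems V_Suc_le[of L] by (auto simp: d_def)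
  then obtain w where "length w = L" "greedy w" "wval V w = n - d * V L"
    using Suc.IH by blast
  then show ?case using Suc.prems
    by (intro exI[of _ "d # w"]) (auto simp: d_def)
qed

lemma greedy_rep_exists:
  assumes "n > 0"
  shows "\<exists>w. greedy_rep V n w"
proof -
  obtain k where k: "V k \<le> n" "n < V (Suc k)" using V_bracket[OF assms] .
  obtain w where w: "length w = Suc k" "greedy w" "wval V w = n"
    using greedy_exists[OF k(2)] by blast
  obtain d w' where dw: "w = d # w'" "length w' = k" using w by (cases w) auto
  have "d \<noteq> 0"
  proof
    assume "d = 0"
    then show False using w k greedy_less[of w'] by (auto simp: dw)
  qed
  then have "greedy_rep V n w" using w by (auto simp: greedy_rep_iff dw)
  then show ?thesis by blast
qed

lemma greedy_rep_unique:
  assumes "greedy_rep V n v" "greedy_rep V n w"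
  shows "v = w"
proof -
  have v: "v \<noteq> []" "hd v \<noteq> 0" "greedy v" "wval V v = n"
    and w: "w \<noteq> []" "hd w \<noteq> 0" "greedy w" "wval V w = n"
    using assms by (auto simp: greedy_rep_iff)
  have "n > 0" using v V_pos by (cases v) auto
  then obtain k where k: "V k \<le> n" "n < V (Suc k)" by (rule V_bracket)
  show ?thesis
    using greedy_inj[OF v(3) w(3)] greedy_length[OF v(3,1,2), of k]
      greedy_length[OF w(3,1,2), of k] k v(4) w(4) by simp
qed

lemma rep_eqI:
  assumes "greedy_rep V n w"
  shows "rep V n = w"
proof -
  have "n > 0" using assms V_pos by (cases w) (auto simp: greedy_rep_iff)
  then show ?thesis
    unfolding rep_def using assms greedy_rep_unique by (auto intro!: the_equality)
qed

lemma greedy_rep_rep: "n > 0 \<Longrightarrow> greedy_rep V n (rep V n)"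
  using greedy_rep_exists rep_eqI by metis

lemma greedy_replicate_0: "greedy (replicate n 0)"
  by (induction n) (auto simp: wval_replicate_0 V_pos)

lemma rep_V: "rep V (V n) = 1 # replicate n 0"
  by (rule rep_eqI) (simp add: greedy_rep_iff wval_replicate_0 greedy_replicate_0 V_less_Suc)


section \<open>An automaton recognizing greedy words\<close>

text \<open>The largest greedy words are the prefixes of \<open>11(01)\<^sup>\<omega>\<close>. After state 1 has been reached by
  reading a 1, or after \<open>11(01)\<^sup>k0\<close>, the continuation must be at most \<open>(10)\<^sup>\<omega>\<close>; in state 2, at most
  \<open>(01)\<^sup>\<omega>\<close>. State 3 is the sink.\<close>

definition step :: "nat \<Rightarrow> nat \<Rightarrow> nat" where
  "step s d =
    (if d = 0 then (if s = 2 then 1 else if s = 3 then 3 else 0)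
     else if d = 1 then (if s = 0 then 1 else if s = 1 then 2 else 3)
     else 3)"

text \<open>Exclusive upper limit for the value of a continuation of length \<open>l\<close> from
  state \<open>s\<close>: \<open>V\<close> at the total length minus the weights of the ones just
  read (none, 1 or 11). The sink admits nothing. Integers avoid truncated subtraction.\<close>

definition bound :: "nat \<Rightarrow> nat \<Rightarrow> int" where
  "bound s l =
    (if s = 0 then int (V l)
     else if s = 1 then int (V (Suc l)) - int (V l)
     else if s = 2 then int (V (Suc (Suc l))) - int (V (Suc l)) - int (V l)
     else 0)"

lemma step_le: "s \<le> 3 \<Longrightarrow> step s d \<le> 3"
  by (simp add: step_def)

lemma foldl_step_le: "s \<le> 3 \<Longrightarrow> foldl step s w \<le> 3"
  by (induction w arbitrary: s) (auto simp: step_le)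

text \<open>Reading a digit subtracts its weight from the limit. The recurrence gives
  \<open>bound 2 (Suc l) = bound 1 l\<close>, which closes the transition from 2 to 1. Reading 0 in
  state 0 or 1 leaves a limit of at least \<open>V l\<close>, so only greediness of the tail
  remains.\<close>

lemma foldl_step_iff:
  "s \<le> 3 \<Longrightarrow> foldl step s w \<noteq> 3 \<longleftrightarrow> greedy w \<and> int (wval V w) < bound s (length w)"
proof (induction w arbitrary: s)
  case Nil
  then have "s \<in> {0, 1, 2, 3}" by auto
  then show ?case by (auto simp: bound_def)
next
  case (Cons d w)
  define l where "l = length w"
  have IH: "foldl step (step s d) w \<noteq> 3 \<longleftrightarrow>
      greedy w \<and> int (wval V w) < bound (step s d) l"
    using Cons.IH[of "step s d"] Cons.prems step_le by (simp add: l_def)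
  have less: "wval V w < V l" if "greedy w"
    using greedy_less[OF that] by (simp add: l_def)
  note V = V_growth[of l] V_rec[of l]
  consider "d = 0" | "d = 1" | "d \<ge> 2" by linarith
  then have "greedy w \<and> int (wval V w) < bound (step s d) l \<longleftrightarrow>
      greedy (d # w) \<and> int (wval V (d # w)) < bound s (Suc l)"
  proof cases
    case 1
    have "s \<in> {0, 1, 2, 3}" using Cons.prems by auto
    then show ?thesis using less V
      by (cases "greedy w") (auto simp: 1 step_def bound_def l_def[symmetric])
  next
    case 2
    have "s \<in> {0, 1, 2, 3}" using Cons.prems by auto
    then show ?thesis using less V
      by (cases "greedy w") (auto simp: 2 step_def bound_def l_def[symmetric])
  next
    case 3
    then have "\<not> greedy (d # w)" using greedy_binary[of "d # w"] by auto
    moreover have "step s d = 3" using 3 by (simp add: step_def)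
    ultimately show ?thesis by (auto simp: bound_def)
  qed
  then show ?case using IH by (simp add: l_def)
qed

lemma greedy_iff_step: "greedy w \<longleftrightarrow> foldl step 0 w \<noteq> 3"
  using foldl_step_iff[of 0 w] greedy_less[of w] by (auto simp: bound_def)


section \<open>The characteristic polynomial\<close>

definition cubic :: "real \<Rightarrow> real" where
  "cubic x = x ^ 3 - x ^ 2 - 2 * x + 1"

lemma cubic_root:
  assumes "a \<le> b" "cubic a \<le> 0 \<and> 0 \<le> cubic b \<or> 0 \<le> cubic a \<and> cubic b \<le> 0"
  obtains x where "a \<le> x" "x \<le> b" "cubic x = 0"
proof -
  have "continuous_on {a..b} cubic"
    unfolding cubic_def by (intro continuous_intros)
  then show ?thesis
    using assms IVT'[of cubic a 0 b] IVT2'[of cubic b 0 a] that by blast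
qed

lemma V_closed_form:
  fixes \<beta> \<gamma> \<delta> :: real
  assumes roots: "cubic \<beta> = 0" "cubic \<gamma> = 0" "cubic \<delta> = 0"
    and distinct: "\<beta> \<noteq> \<gamma>" "\<beta> \<noteq> \<delta>" "\<gamma> \<noteq> \<delta>" and "\<beta> \<noteq> 2" "\<delta> \<noteq> 2"
  obtains a b c where "b \<noteq> 0" "\<And>n. real (V n) = a * \<beta> ^ n + b * \<gamma> ^ n + c * \<delta> ^ n"
proof -
  \<comment> \<open>The initial values 1, 2, 4 are powers of 2, so the coefficients are the Lagrange
    basis polynomials of the three roots evaluated at 2, written over the Vandermonde product
    \<open>D\<close>.\<close>
  define D where "D = (\<beta> - \<gamma>) * (\<beta> - \<delta>) * (\<gamma> - \<delta>)"
  define a where "a = (2 - \<gamma>) * (2 - \<delta>) * (\<gamma> - \<delta>) / D"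
  define b where "b = - (2 - \<beta>) * (2 - \<delta>) * (\<beta> - \<delta>) / D"
  define c where "c = (2 - \<beta>) * (2 - \<gamma>) * (\<beta> - \<gamma>) / D"
  have D: "D \<noteq> 0" using distinct by (simp add: D_def)
  have rec: "x ^ Suc (Suc (Suc n)) = x ^ Suc (Suc n) + 2 * x ^ Suc n - x ^ n"
    if "cubic x = 0" for x :: real and n
  proof -
    have "x ^ 3 = x ^ 2 + 2 * x - 1" using that by (simp add: cubic_def)
    then have "x ^ n * x ^ 3 = x ^ n * (x ^ 2 + 2 * x - 1)" by simp
    then show ?thesis by (simp add: algebra_simps power3_eq_cube power2_eq_square)
  qed
  have V: "real (V n) = a * \<beta> ^ n + b * \<gamma> ^ n + c * \<delta> ^ n" for n
  proof (induction n rule: V.induct)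
    case 1
    have "D * (a + b + c) = D * 1" using D
      by (simp add: a_def b_def c_def distrib_left) (simp add: D_def algebra_simps)
    then show ?case using D by simp
  next
    case 2
    have "D * (a * \<beta> + b * \<gamma> + c * \<delta>) = D * 2" using D
      by (simp add: a_def b_def c_def distrib_left) (simp add: D_def algebra_simps)
    then show ?case using D by simp
  next
    case 3
    have "D * (a * \<beta>\<^sup>2 + b * \<gamma>\<^sup>2 + c * \<delta>\<^sup>2) = D * 4" using D
      by (simp add: a_def b_def c_def distrib_left)
        (simp add: D_def algebra_simps power2_eq_square)
    then show ?case using D by (simp add: power2_eq_square)
  next
    case (4 n)
    have "real (V (Suc (Suc (Suc n)))) = real (V (Suc (Suc n))) + 2 * real (V (Suc n)) - real (V n)"
      using V_rec[of n] by linarith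
    then show ?case unfolding 4 rec[OF roots(1)] rec[OF roots(2)] rec[OF roots(3)]
      by (simp add: algebra_simps)
  qed
  have "b \<noteq> 0" using assms D by (simp add: b_def)
  then show ?thesis using V that by blast
qed

lemma wval_closed_form:
  fixes \<beta> \<gamma> \<delta> :: real
  assumes "\<And>n. real (V n) = a * \<beta> ^ n + b * \<gamma> ^ n + c * \<delta> ^ n"
  shows "real (wval V w) = a * wval ((^) \<beta>) w + b * wval ((^) \<gamma>) w + c * wval ((^) \<delta>) w"
  by (induction w) (simp_all add: assms algebra_simps)

text \<open>Combining the instances \<open>i\<close> = 0, ..., 3 with the coefficients of (t - 1)(t
  - X)(t - Z) annihilates every term except the one with base \<open>Y\<close>.\<close>

lemma exponential_sum_coeff_0:
  fixes A B C D X Y Z :: real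
  assumes "\<And>i. A * X ^ i + B * Y ^ i + C * Z ^ i + D = 0"
    and "Y \<noteq> 1" "Y \<noteq> X" "Y \<noteq> Z"
  shows "B = 0"
proof -
  have "B * ((Y - 1) * (Y - X) * (Y - Z)) =
      (A * X ^ 3 + B * Y ^ 3 + C * Z ^ 3 + D)
      - (1 + X + Z) * (A * X ^ 2 + B * Y ^ 2 + C * Z ^ 2 + D)
      + (X + Z + X * Z) * (A * X ^ 1 + B * Y ^ 1 + C * Z ^ 1 + D)
      - X * Z * (A * X ^ 0 + B * Y ^ 0 + C * Z ^ 0 + D)"
    by (simp add: algebra_simps power3_eq_cube power2_eq_square)
  then show ?thesis using assms by (simp only: assms(1)) simp
qed


section \<open>Words evaluated at a negative base\<close>

text \<open>The numbers \<open>\<Sum>i. d\<^sub>i / \<gamma> ^ Suc i\<close> with binary digits, for \<open>\<gamma> < - 1\<close>, lie in the interval with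
  endpoints \<open>\<gamma> / (\<gamma>\<^sup>2 - 1)\<close> and \<open>1 / (\<gamma>\<^sup>2 - 1)\<close>.\<close>

lemma one_less_square:
  fixes x :: real
  assumes "x < - 1"
  shows "1 < x\<^sup>2"
  using assms one_less_power[of "- x" 2] by simp

definition fractional :: "real \<Rightarrow> real \<Rightarrow> bool" where
  "fractional \<gamma> y \<longleftrightarrow> \<gamma> \<le> y * (\<gamma>\<^sup>2 - 1) \<and> y * (\<gamma>\<^sup>2 - 1) \<le> 1"

text \<open>After scaling by \<open>\<gamma>\<^sup>2 - 1\<close>, adding a digit moves the interval
  from \<gamma> to 1 into the one from \<gamma> to \<open>\<gamma>\<^sup>2\<close>; division by the
  negative \<gamma> maps the latter back, swapping the endpoints.\<close>

lemma fractional_digit: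
  assumes "\<gamma> < - 1" "fractional \<gamma> y" "d \<in> {0, 1 :: nat}"
  shows "fractional \<gamma> ((real d + y) / \<gamma>)"
proof -
  have "\<gamma>\<^sup>2 - 1 > 0" using one_less_square[OF assms(1)] by simp
  then have "0 \<le> real d * (\<gamma>\<^sup>2 - 1)" "real d * (\<gamma>\<^sup>2 - 1) \<le> \<gamma>\<^sup>2 - 1"
    using assms(3) by auto
  then have "\<gamma> \<le> (real d + y) * (\<gamma>\<^sup>2 - 1)" "(real d + y) * (\<gamma>\<^sup>2 - 1) \<le> \<gamma> * \<gamma>"
    using assms(2) unfolding fractional_def distrib_right by (auto simp: power2_eq_square)
  then show ?thesis unfolding fractional_def using assms(1)
    by (simp add: field_simps)
qed

lemma fractional_word:
  assumes "\<gamma> < - 1" "fractional \<gamma> y" "set w \<subseteq> {0, 1}"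
  shows "fractional \<gamma> ((wval ((^) \<gamma>) w + y) / \<gamma> ^ length w)"
  using assms(3)
proof (induction w)
  case (Cons d w)
  have "fractional \<gamma> ((real d + (wval ((^) \<gamma>) w + y) / \<gamma> ^ length w) / \<gamma>)"
    using Cons assms(1) by (intro fractional_digit) auto
  then show ?case using assms(1) by (simp add: field_simps)
qed (use assms in simp)

text \<open>The value is the fixed point of \<open>y\<close> ->
  \<open>(wval ((^) \<gamma>) v + y) / P\<close>. Even length gives \<open>P > 1\<close>, so this
  map is an increasing contraction; it sends both endpoints into the interval, which therefore
  contains the fixed point.\<close>

lemma fractional_periodic:
  assumes "\<gamma> < - 1" "set v \<subseteq> {0, 1}" "even (length v)" "v \<noteq> []"
  shows "fractional \<gamma> (wval ((^) \<gamma>) v / (\<gamma> ^ length v - 1))"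
proof -
  define P where "P = \<gamma> ^ length v"
  define h where "h = \<gamma>\<^sup>2 - 1"
  have h: "h > 0" using one_less_square[OF assms(1)] by (simp add: h_def)
  have "P = \<bar>\<gamma>\<bar> ^ length v" using assms(3) by (simp add: P_def power_even_abs)
  then have P: "P > 1" using assms(1,4) by (simp only:) (rule one_less_power, auto)
  have "fractional \<gamma> (1 / h)" "fractional \<gamma> (\<gamma> / h)"
    using h assms(1) by (auto simp: fractional_def simp flip: h_def)
  then have "fractional \<gamma> ((wval ((^) \<gamma>) v + 1 / h) / P)" "fractional \<gamma> ((wval ((^) \<gamma>) v + \<gamma> / h) / P)"
    unfolding P_def using fractional_word[OF assms(1) _ assms(2)] by blast+
  moreover have "(wval ((^) \<gamma>) v + c / h) / P * h = (wval ((^) \<gamma>) v * h + c) / P" for c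
    using h P by (simp add: field_simps)
  ultimately have "wval ((^) \<gamma>) v * h + 1 \<le> P" "\<gamma> * P \<le> wval ((^) \<gamma>) v * h + \<gamma>"
    unfolding fractional_def h_def[symmetric] using P by (simp_all add: pos_divide_le_eq pos_le_divide_eq)
  then show ?thesis
    unfolding fractional_def P_def[symmetric] h_def[symmetric] using P by (simp add: field_simps)
qed

text \<open>The length condition makes \<open>k\<close> affine in \<open>i\<close>, so
  \<open>2 * V k\<close> and the value of the pumped word are exponential sums in \<open>i\<close>
  with the same bases.\<close>

lemma no_pumping:
  fixes u v z u' :: "nat list"
  assumes u: "u = 1 # u'" and binary: "set u \<subseteq> {0, 1}" "set v \<subseteq> {0, 1}"
    and v: "even (length v)" "v \<noteq> []"
    and pump: "\<And>i. \<exists>k. 2 * V k = wval V (u @ concat (replicate i v) @ z) \<and>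
                    length (u @ concat (replicate i v) @ z) = k + 2"
  shows False
proof -
  obtain \<beta> where \<beta>: "9/5 \<le> \<beta>" "\<beta> \<le> 19/10" "cubic \<beta> = 0"
    by (rule cubic_root[of "9/5" "19/10"]) (auto simp: cubic_def power2_eq_square power3_eq_cube)
  obtain \<gamma> where \<gamma>: "-5/4 \<le> \<gamma>" "\<gamma> \<le> -6/5" "cubic \<gamma> = 0"
    by (rule cubic_root[of "-5/4" "-6/5"]) (auto simp: cubic_def power2_eq_square power3_eq_cube)
  obtain \<delta> where \<delta>: "1/4 \<le> \<delta>" "\<delta> \<le> 1/2" "cubic \<delta> = 0"
    by (rule cubic_root[of "1/4" "1/2"]) (auto simp: cubic_def power2_eq_square power3_eq_cube)
  obtain a b c where abc: "b \<noteq> 0" "\<And>n. real (V n) = a * \<beta> ^ n + b * \<gamma> ^ n + c * \<delta> ^ n"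
    by (rule V_closed_form[of \<beta> \<gamma> \<delta>]) (use \<beta> \<gamma> \<delta> in auto)
  define p where "p = length v"
  have p: "p > 0" "even p" using v by (auto simp: p_def)
  define y where "y x = wval ((^) x) v / (x ^ p - 1)" for x :: real
  \<comment> \<open>\<open>R x\<close> collects the coefficient of \<open>(x ^ p) ^ i\<close> and
    \<open>S x\<close> the part constant in \<open>i\<close>. The division by
    \<open>x\<^sup>2\<close> accounts for \<open>k\<close> being the length minus 2.\<close>
  define R where "R x = 2 * x ^ (length u + length z) / x\<^sup>2 - x ^ length z * (wval ((^) x) u + y x)"
    for x :: real
  define S where "S x = x ^ length z * y x - wval ((^) x) z" for x :: real
  \<comment> \<open>These separate the base \<open>\<gamma> ^ p\<close> from the other three bases
    \<open>\<beta> ^ p\<close>, \<open>\<delta> ^ p\<close> and 1; evenness of \<open>p\<close>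
    makes it positive.\<close>
  have pow: "\<beta> ^ p > \<gamma> ^ p" "\<gamma> ^ p > 1" "\<delta> ^ p < 1"
  proof -
    have "\<gamma> ^ p = \<bar>\<gamma>\<bar> ^ p" using p by (simp add: power_even_abs)
    moreover have "\<bar>\<gamma>\<bar> ^ p < \<beta> ^ p" using p \<beta> \<gamma> by (intro power_strict_mono) auto
    moreover have "1 < \<bar>\<gamma>\<bar> ^ p" using p \<gamma> by (intro one_less_power) auto
    ultimately show "\<beta> ^ p > \<gamma> ^ p" "\<gamma> ^ p > 1" by auto
    show "\<delta> ^ p < 1" using p \<delta> power_strict_mono[of \<delta> 1 p] by simp
  qed
  have val: "2 * x ^ k - wval ((^) x) (u @ concat (replicate i v) @ z) = R x * (x ^ p) ^ i + S x"
    if k: "length (u @ concat (replicate i v) @ z) = k + 2" and x: "x \<noteq> 0" "x ^ p \<noteq> 1"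
    for x :: real and k i
  proof -
    have len: "length (concat (replicate i v)) = p * i"
      by (induction i) (auto simp: p_def)
    have "x ^ k * x\<^sup>2 = x ^ (length u + length z) * (x ^ p) ^ i"
      using k unfolding power_add[symmetric] power_mult[symmetric] by (simp add: len add_ac)
    then have 1: "2 * x ^ k = 2 * x ^ (length u + length z) / x\<^sup>2 * (x ^ p) ^ i"
      using x by (simp add: field_simps)
    have "wval ((^) x) (concat (replicate i v)) = y x * ((x ^ p) ^ i - 1)"
      using wval_power_concat_replicate[of x i v] x by (simp add: y_def p_def field_simps)
    then have "wval ((^) x) (u @ concat (replicate i v) @ z) =
        x ^ (p * i) * x ^ length z * wval ((^) x) u
        + x ^ length z * (y x * ((x ^ p) ^ i - 1)) + wval ((^) x) z"
      by (simp add: wval_power_append len power_add)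
    then show ?thesis unfolding 1 R_def S_def power_mult by (simp add: algebra_simps)
  qed
  have sum0: "a * R \<beta> * (\<beta> ^ p) ^ i + b * R \<gamma> * (\<gamma> ^ p) ^ i + c * R \<delta> * (\<delta> ^ p) ^ i
      + (a * S \<beta> + b * S \<gamma> + c * S \<delta>) = 0" for i
  proof -
    obtain k where k: "2 * V k = wval V (u @ concat (replicate i v) @ z)"
        "length (u @ concat (replicate i v) @ z) = k + 2"
      using pump by blast
    let ?w = "u @ concat (replicate i v) @ z"
    have "2 * real (V k) = real (wval V ?w)" using k(1) by (metis of_nat_mult of_nat_numeral)
    then have "a * (2 * \<beta> ^ k - wval ((^) \<beta>) ?w) + b * (2 * \<gamma> ^ k - wval ((^) \<gamma>) ?w)
        + c * (2 * \<delta> ^ k - wval ((^) \<delta>) ?w) = 0"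
      unfolding wval_closed_form[OF abc(2)] abc(2) by (simp add: algebra_simps)
    moreover have "\<beta> \<noteq> 0" "\<gamma> \<noteq> 0" "\<delta> \<noteq> 0" "\<beta> ^ p \<noteq> 1" "\<gamma> ^ p \<noteq> 1" "\<delta> ^ p \<noteq> 1"
      using \<beta> \<gamma> \<delta> pow by auto
    ultimately show ?thesis
      using val[OF k(2)] by (simp add: algebra_simps)
  qed
  have "b * R \<gamma> = 0"
    by (rule exponential_sum_coeff_0[OF sum0]) (use pow in auto)
  then have "R \<gamma> = 0" using abc(1) by simp
  then have "\<gamma> ^ length z * (\<gamma> ^ length u * (2 / \<gamma>\<^sup>2)) = \<gamma> ^ length z * (wval ((^) \<gamma>) u + y \<gamma>)"
    by (simp add: R_def power_add mult_ac)
  then have eq: "\<gamma> ^ length u * (2 / \<gamma>\<^sup>2) = wval ((^) \<gamma>) u + y \<gamma>"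
    using \<gamma> by (simp only: mult_cancel_left) simp
  \<comment> \<open>The contribution of all digits after the leading 1, as a fractional part in base
    \<gamma>.\<close>
  define y' where "y' = (wval ((^) \<gamma>) u' + y \<gamma>) / \<gamma> ^ length u'"
  have "fractional \<gamma> (y \<gamma>)"
    unfolding y_def p_def using \<gamma> binary v by (intro fractional_periodic) auto
  then have "fractional \<gamma> y'"
    unfolding y'_def using \<gamma> binary by (intro fractional_word) (auto simp: u)
  moreover have "\<gamma> ^ length u' * (1 + y') = \<gamma> ^ length u' * (2 / \<gamma>)"
  proof -
    have "\<gamma> ^ length u' * y' = wval ((^) \<gamma>) u' + y \<gamma>" using \<gamma> by (simp add: y'_def)
    then show ?thesis using eq \<gamma> by (simp add: u distrib_left power2_eq_square)
  qed
  then have "1 + y' = 2 / \<gamma>" using \<gamma> by (simp only: mult_cancel_left) simp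
  then have "y' = 2 / \<gamma> - 1" by simp
  ultimately have "\<gamma> \<le> (2 / \<gamma> - 1) * (\<gamma>\<^sup>2 - 1)" by (simp add: fractional_def)
  then have "\<gamma> * ((2 / \<gamma> - 1) * (\<gamma>\<^sup>2 - 1)) \<le> \<gamma> * \<gamma>"
    using \<gamma> by (intro mult_left_mono_neg) auto
  moreover have "\<gamma> * ((2 / \<gamma> - 1) * (\<gamma>\<^sup>2 - 1)) = (2 - \<gamma>) * (\<gamma>\<^sup>2 - 1)"
    using \<gamma> by (simp add: field_simps)
  \<comment> \<open>Replacing \<open>\<gamma> ^ 3\<close> by means of
    \<open>cubic \<gamma> = 0\<close> reduces the inequality to -1 \<le> \<gamma>.\<close>
  ultimately show False
    using \<gamma> by (simp add: cubic_def algebra_simps power2_eq_square power3_eq_cube)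
qed


section \<open>The Parry number\<close>

text \<open>The word \<open>11(01)\<^sup>\<omega>\<close>, indexed from 0.\<close>

definition parry_digits :: "nat \<Rightarrow> nat" where
  "parry_digits i = (if i = 0 \<or> odd i then 1 else 0)"

locale parry_base =
  fixes \<beta> :: real
  assumes gt_1: "1 < \<beta>" and less_2: "\<beta> < 2" and root: "cubic \<beta> = 0"
begin

text \<open>The orbit of 1 under the \<open>\<beta>\<close>-transformation.\<close>

definition orbit :: "nat \<Rightarrow> real" where
  "orbit n = (if n = 0 then 1 else if odd n then \<beta> - 1 else \<beta>\<^sup>2 - \<beta> - 1)"

text \<open>The equation \<open>cubic \<beta> = 0\<close> is exactly what closes the orbit into a
  cycle of length 2 after its first point.\<close>

lemma orbit_Suc: "orbit (Suc n) = \<beta> * orbit n - parry_digits n"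
  using root by (auto simp: orbit_def parry_digits_def cubic_def algebra_simps
      power2_eq_square power3_eq_cube)

lemma orbit_less_1:
  assumes "n > 0"
  shows "orbit n < 1"
proof -
  have "\<beta> * (\<beta> - 1) < 2 * 1" using gt_1 less_2 by (intro mult_strict_mono) auto
  then show ?thesis
    using assms less_2 by (auto simp: orbit_def algebra_simps power2_eq_square)
qed

lemma orbit_bounded: "\<bar>orbit n\<bar> \<le> 1"
proof -
  have "\<beta> * (\<beta> - 1) > 0" using gt_1 by simp
  then have "orbit n \<ge> -1"
    using gt_1 by (auto simp: orbit_def algebra_simps power2_eq_square)
  then show ?thesis using orbit_less_1[of n] by (cases "n = 0") (auto simp: orbit_def)
qed

lemma sum_parry_digits: "(\<Sum>i<n. real (parry_digits i) / \<beta> ^ Suc i) = 1 - orbit n / \<beta> ^ n"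
proof (induction n)
  case (Suc n)
  show ?case unfolding sum.lessThan_Suc Suc.IH orbit_Suc
    using gt_1 by (simp add: field_simps)
qed (simp add: orbit_def)

lemma beta_rep_parry_digits: "beta_rep \<beta> 1 parry_digits"
proof -
  have "(\<lambda>n. (1 / \<beta>) ^ n) \<longlonglongrightarrow> 0" using gt_1 by (intro LIMSEQ_power_zero) simp
  then have "(\<lambda>n. orbit n / \<beta> ^ n) \<longlonglongrightarrow> 0"
  proof (rule tendsto_0_le)
    show "\<forall>\<^sub>F n in sequentially. norm (orbit n / \<beta> ^ n) \<le> norm ((1 / \<beta>) ^ n) * 1"
      using gt_1 orbit_bounded
      by (intro always_eventually) (simp add: abs_divide power_divide divide_right_mono)
  qed
  then have "(\<lambda>n. 1 - orbit n / \<beta> ^ n) \<longlonglongrightarrow> 1 - 0" by (intro tendsto_diff tendsto_const)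
  then show ?thesis unfolding beta_rep_def sums_def sum_parry_digits by simp
qed

text \<open>If \<open>e\<close> had the larger digit at the first difference \<open>k\<close>, its
  partial sum through \<open>k\<close> would already exceed 1, since
  \<open>orbit (Suc k) < 1\<close>.\<close>

lemma lex_less_parry_digits:
  assumes e: "beta_rep \<beta> 1 e" and "e \<noteq> parry_digits"
  shows "lex_less e parry_digits"
proof -
  define k where "k = (LEAST k. e k \<noteq> parry_digits k)"
  have "\<exists>k. e k \<noteq> parry_digits k" using assms(2) by auto
  then have k: "e k \<noteq> parry_digits k" unfolding k_def by (rule LeastI_ex)
  have below: "e i = parry_digits i" if "i < k" for i
    using not_less_Least[OF that[unfolded k_def]] by simp
  have "\<not> parry_digits k < e k"
  proof
    assume "parry_digits k < e k"
    then have ek: "real (parry_digits k) + 1 \<le> real (e k)" by linarith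
    have "(\<Sum>i<k. real (e i) / \<beta> ^ Suc i) = 1 - orbit k / \<beta> ^ k"
      unfolding sum_parry_digits[symmetric] using below by (intro sum.cong) auto
    then have "(\<Sum>i<Suc k. real (e i) / \<beta> ^ Suc i) = 1 - orbit k / \<beta> ^ k + real (e k) / \<beta> ^ Suc k"
      by simp
    also have "\<dots> \<ge> 1 - orbit k / \<beta> ^ k + (real (parry_digits k) + 1) / \<beta> ^ Suc k"
      using ek gt_1 by (intro add_left_mono divide_right_mono) auto
    also have "1 - orbit k / \<beta> ^ k + (real (parry_digits k) + 1) / \<beta> ^ Suc k =
        1 + (1 - orbit (Suc k)) / \<beta> ^ Suc k"
      using gt_1 by (simp add: orbit_Suc field_simps)
    finally have "(\<Sum>i<Suc k. real (e i) / \<beta> ^ Suc i) \<ge> 1 + (1 - orbit (Suc k)) / \<beta> ^ Suc k" .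
    moreover have "(1 - orbit (Suc k)) / \<beta> ^ Suc k > 0"
      using orbit_less_1[of "Suc k"] gt_1 by (intro divide_pos_pos) auto
    moreover have "(\<Sum>i<Suc k. real (e i) / \<beta> ^ Suc i) \<le> 1"
      using e[unfolded beta_rep_def] gt_1
      by (simp only: sums_iff) (metis (no_types, lifting) sum_le_suminf finite_lessThan
          divide_nonneg_pos of_nat_0_le_iff zero_less_power zero_less_one order.strict_trans)
    ultimately show False by linarith
  qed
  then have "e k < parry_digits k" using k by linarith
  then show ?thesis unfolding lex_less_def using below by blast
qed

lemma lex_less_antisym: "lex_less d e \<Longrightarrow> \<not> lex_less e d"
  unfolding lex_less_def by (metis linorder_neqE_nat less_asym less_irrefl)

lemma beta_expansion_1: "beta_expansion \<beta> 1 = parry_digits"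
  unfolding beta_expansion_def
proof (rule the_equality)
  show "beta_rep \<beta> 1 parry_digits \<and> (\<forall>e. beta_rep \<beta> 1 e \<longrightarrow> e = parry_digits \<or> lex_less e parry_digits)"
    using beta_rep_parry_digits lex_less_parry_digits by blast
next
  fix d assume d: "beta_rep \<beta> 1 d \<and> (\<forall>e. beta_rep \<beta> 1 e \<longrightarrow> e = d \<or> lex_less e d)"
  then show "d = parry_digits"
    using beta_rep_parry_digits lex_less_parry_digits lex_less_antisym by metis
qed

lemma quasi_greedy_expansion: "quasi_greedy_expansion \<beta> = parry_digits"
proof -
  have "\<not> finite_length parry_digits m" for m
  proof
    assume "finite_length parry_digits m"
    then have "parry_digits (2 * m + 1) = 0" by (simp add: finite_length_def)
    then show False by (simp add: parry_digits_def)
  qed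
  then show ?thesis
    unfolding quasi_greedy_expansion_def beta_expansion_1 Let_def by (intro if_not_P) blast
qed

lemma Parry_number: "Parry_number \<beta>"
  unfolding Parry_number_def ultimately_periodic_def quasi_greedy_expansion
  using gt_1 by (intro conjI exI[of _ 1] exI[of _ 2]) (auto simp: parry_digits_def)

text \<open>The digits have period 2 after the first one, so the convolutions for indices
  \<open>Suc n\<close> and \<open>n + 3\<close> have the same tail; eliminating it leaves the
  recurrence of \<open>V\<close>.\<close>

lemma canonical_system: "canonical_system \<beta> = V"
proof
  define W where "W = canonical_system \<beta>"
  have W: "W n = (\<Sum>i<n. parry_digits i * W (n - Suc i)) + 1" for n
    unfolding W_def by (subst canonical_system.simps) (simp add: quasi_greedy_expansion)
  have W_Suc: "W (Suc n) = W n + (\<Sum>i<n. parry_digits (Suc i) * W (n - Suc i)) + 1" for n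
    by (subst W) (simp add: sum.lessThan_Suc_shift parry_digits_def del: sum.lessThan_Suc)
  have rec: "W (Suc (Suc (Suc n))) + W n = W (Suc (Suc n)) + 2 * W (Suc n)" for n
  proof -
    have "W (Suc (Suc (Suc n))) =
        W (Suc (Suc n)) + (W (Suc n) + (\<Sum>i<n. parry_digits (Suc (Suc (Suc i))) * W (n - Suc i))) + 1"
      by (subst W_Suc) (simp add: sum.lessThan_Suc_shift parry_digits_def del: sum.lessThan_Suc)
    also have "(\<Sum>i<n. parry_digits (Suc (Suc (Suc i))) * W (n - Suc i)) =
        (\<Sum>i<n. parry_digits (Suc i) * W (n - Suc i))"
      by (simp add: parry_digits_def)
    finally show ?thesis using W_Suc[of n] by simp
  qed
  have init: "W 0 = 1" "W (Suc 0) = 2" "W (Suc (Suc 0)) = 4"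
    using W[of 0] W_Suc[of 0] W_Suc[of "Suc 0"] by (simp_all add: parry_digits_def)
  have "W n = V n" for n
  proof (induction n rule: V.induct)
    case (4 n)
    then show ?case using rec[of n] V_rec[of n] by linarith
  qed (use init in simp_all)
  then show "canonical_system \<beta> n = V n" for n by (simp add: W_def)
qed

end

lemma Parry_numeration_system_V: "Parry_numeration_system V"
proof -
  obtain \<beta> where \<beta>: "9/5 \<le> \<beta>" "\<beta> \<le> 19/10" "cubic \<beta> = 0"
    by (rule cubic_root[of "9/5" "19/10"]) (auto simp: cubic_def power2_eq_square power3_eq_cube)
  then interpret parry_base \<beta> by unfold_locales auto
  show ?thesis
    unfolding Parry_numeration_system_def
    using numeration_system_V Parry_number canonical_system by auto
qed


section \<open>Automata\<close>

definition char_seq :: "nat set \<Rightarrow> nat stream" where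
  "char_seq S = smap (\<lambda>n. if n \<in> S then 1 else 0) nats"

lemma snth_char_seq: "char_seq S !! n = (if n \<in> S then 1 else 0)"
  by (simp add: char_seq_def)

lemma automatic_char_range_V: "automatic V {0, 1} (char_seq (range V))"
proof -
  \<comment> \<open>State 0: only zeros read; state 1: exactly one 1 besides zeros; state 2:
    sink.\<close>
  define \<delta> :: "nat \<Rightarrow> nat \<Rightarrow> nat" where
    "\<delta> q d = (if d = 0 then q else if d = 1 \<and> q = 0 then 1 else 2)" for q d
  define M :: "(nat, nat) dfao" where
    "M = \<lparr>states = {0, 1, 2}, init = 0, trans = \<delta>, outp = (\<lambda>q. if q = 1 then 1 else 0)\<rparr>"
  have sink: "foldl \<delta> 2 w = 2" for w
    by (induction w) (auto simp: \<delta>_def)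
  have tail: "foldl \<delta> 1 w = 1 \<longleftrightarrow> w = replicate (length w) 0" for w
  proof (induction w)
    case (Cons d w)
    have "\<delta> 1 d = (if d = 0 then 1 else 2)" by (simp add: \<delta>_def)
    then show ?case using Cons sink[of w] by simp
  qed simp
  have accept: "foldl \<delta> 0 w = 1 \<longleftrightarrow> w = 1 # replicate (length w - 1) 0" if "w \<noteq> []" "hd w \<noteq> 0" for w
  proof -
    obtain d w' where w: "w = d # w'" using \<open>w \<noteq> []\<close> by (cases w) auto
    have "\<delta> 0 d = (if d = 1 then 1 else 2)" using that by (simp add: w \<delta>_def)
    then show ?thesis using tail[of w'] sink[of w'] by (simp add: w)
  qed
  have "n \<in> range V \<longleftrightarrow> foldl \<delta> 0 (rep V n) = 1" for n
  proof (cases "n = 0")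
    case True
    have "0 \<notin> range V" using V_pos by (metis imageE less_irrefl)
    then show ?thesis by (simp add: True rep_def)
  next
    case False
    then have n: "greedy_rep V n (rep V n)" by (simp add: greedy_rep_rep)
    then have *: "rep V n \<noteq> []" "hd (rep V n) \<noteq> 0" "wval V (rep V n) = n"
      by (auto simp: greedy_rep_iff)
    show ?thesis
    proof
      assume "n \<in> range V"
      then obtain k where "n = V k" by blast
      then show "foldl \<delta> 0 (rep V n) = 1" using accept[OF *(1,2)] by (simp add: rep_V)
    next
      assume "foldl \<delta> 0 (rep V n) = 1"
      then have w: "rep V n = 1 # replicate (length (rep V n) - 1) 0" using accept[OF *(1,2)] by simp
      have "n = V (length (rep V n) - 1)"
        using *(3) by (subst (asm) w) (simp add: wval_replicate_0)
      then show "n \<in> range V" by blast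
    qed
  qed
  then have "\<forall>n. char_seq (range V) !! n = outp M (foldl (trans M) (init M) (rep V n))"
    by (simp add: snth_char_seq M_def)
  moreover have "complete_dfao (alphabet V) {0, 1} M"
    by (auto simp: complete_dfao_def M_def \<delta>_def)
  moreover have "trans M (init M) 0 = init M" by (simp add: M_def \<delta>_def)
  ultimately show ?thesis unfolding automatic_def by blast
qed

section \<open>Images under uniform substitutions\<close>

lemma snth_subst_image:
  assumes "\<And>a. length (\<mu> a) = l" "j < l"
  shows "subst_image \<mu> x !! (l * n + j) = \<mu> (x !! n) ! j"
proof -
  have "\<mu> a \<noteq> []" for a using assms(1)[of a] assms(2) by auto
  then have flat: "flat (smap \<mu> y) !! m =
      (if m < l then \<mu> (shd y) ! m else flat (smap \<mu> (stl y)) !! (m - l))" for y m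
    using assms(1) by (subst flat_snth) (auto simp: stream.set_map)
  show ?thesis
  proof (induction n arbitrary: x)
    case 0
    show ?case using assms by (simp add: subst_image_def flat)
  next
    case (Suc n)
    have "subst_image \<mu> x !! (l * Suc n + j) = subst_image \<mu> (stl x) !! (l * n + j)"
      by (simp add: subst_image_def flat[of x])
    then show ?case using Suc by simp
  qed
qed

lemma subst_image_char_double:
  "subst_image (\<lambda>a. [a, 0]) (char_seq (range V)) = char_seq ((*) 2 ` range V)"
proof -
  have "subst_image (\<lambda>a. [a, 0]) (char_seq (range V)) !! m = char_seq ((*) 2 ` range V) !! m" for m
  proof -
    have "m = 2 * (m div 2) + m mod 2" "m mod 2 < 2" by auto
    then have "subst_image (\<lambda>a. [a, 0]) (char_seq (range V)) !! m
        = [char_seq (range V) !! (m div 2), 0] ! (m mod 2)"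
      using snth_subst_image[of "\<lambda>a. [a, 0]" 2 "m mod 2" "char_seq (range V)" "m div 2"] by simp
    also have "\<dots> = char_seq ((*) 2 ` range V) !! m"
    proof (cases "even m")
      case True
      then show ?thesis by (auto simp: snth_char_seq elim!: evenE)
    next
      case False
      then show ?thesis by (auto simp: snth_char_seq odd_iff_mod_2_eq_one)
    qed
    finally show ?thesis .
  qed
  then show ?thesis by (metis stream_smap_nats ext)
qed

section \<open>Pumping greedy representations of doubled terms\<close>

lemma foldl_concat_replicate: "foldl f q v = q \<Longrightarrow> foldl f q (concat (replicate i v)) = q"
  by (induction i) auto

lemma not_automatic_double_V: "\<not> automatic V B (char_seq ((*) 2 ` range V))"
proof
  assume "automatic V B (char_seq ((*) 2 ` range V))"
  then obtain M :: "(nat, nat) dfao" where M: "complete_dfao (alphabet V) B M"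
      "\<And>n. char_seq ((*) 2 ` range V) !! n = outp M (foldl (trans M) (init M) (rep V n))"
    unfolding automatic_def by blast
  \<comment> \<open>The product with the greediness automaton: a loop in both components preserves
    the output of \<open>M\<close> and greediness.\<close>
  define run where "run w = (foldl (trans M) (init M) w, foldl step 0 w)" for w
  have closed: "foldl (trans M) q w \<in> states M" if "q \<in> states M" "set w \<subseteq> {0, 1}" for q w
    using that M(1) by (induction w arbitrary: q) (auto simp: complete_dfao_def alphabet_V)
  have run_in: "run w \<in> states M \<times> {..3}" if "set w \<subseteq> {0, 1}" for w
    using closed[OF _ that] foldl_step_le[of 0 w] M(1) by (auto simp: run_def complete_dfao_def)
  have fin: "finite (states M \<times> {..3 :: nat})" using M(1) by (simp add: complete_dfao_def)
  have double: "greedy_rep V (2 * V k) w \<Longrightarrow> length w = k + 2" for k w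
    using greedy_length[of w "Suc k"] V_Suc_le[of k] double_V_less[of k] by (auto simp: greedy_rep_iff)
  \<comment> \<open>\<open>2 * V n\<close> has a representation of length \<open>n + 2\<close>, so
    its prefixes of lengths 1 to \<open>n + 1\<close> outnumber the product states. Excluding the
    empty prefix keeps the leading 1 in \<open>u\<close>.\<close>
  define n where "n = card (states M \<times> {..3 :: nat})"
  define w where "w = rep V (2 * V n)"
  have grw: "greedy_rep V (2 * V n) w" unfolding w_def by (rule greedy_rep_rep) (simp add: V_pos)
  then have w: "w \<noteq> []" "hd w \<noteq> 0" "greedy w" "set w \<subseteq> {0, 1}"
    using greedy_binary by (auto simp: greedy_rep_iff)
  have len: "length w = n + 2" using double[OF grw] .
  have "\<not> inj_on (\<lambda>i. run (take i w)) {1..n + 1}"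
  proof
    assume inj: "inj_on (\<lambda>i. run (take i w)) {1..n + 1}"
    have "(\<lambda>i. run (take i w)) ` {1..n + 1} \<subseteq> states M \<times> {..3}"
      using w(4) by (intro image_subsetI run_in) (meson set_take_subset subset_trans)
    from card_inj_on_le[OF inj this fin] show False by (simp add: n_def)
  qed
  then obtain i j where ij: "1 \<le> i" "i < j" "j \<le> n + 1" "run (take i w) = run (take j w)"
    unfolding inj_on_def by (metis atLeastAtMost_iff linorder_neqE_nat)
  define u v z where "u = take i w" and "v = drop i (take j w)" and "z = drop j w"
  have uv: "u @ v = take j w" using ij
    by (simp add: u_def v_def) (metis append_take_drop_id min.absorb1 less_imp_le take_take)
  then have uvz: "w = u @ v @ z" by (metis append.assoc append_take_drop_id z_def)
  have "v \<noteq> []" using ij len by (auto simp: v_def)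
  obtain d u' where u: "u = d # u'" using ij w(1) by (cases u) (auto simp: u_def)
  have "d = 1" using w(2,4) by (auto simp: uvz u)
  have loop: "foldl (trans M) (foldl (trans M) (init M) u) v = foldl (trans M) (init M) u"
      "foldl step (foldl step 0 u) v = foldl step 0 u"
    using ij(4) unfolding uv[symmetric] u_def[symmetric] run_def by auto
  \<comment> \<open>The loop is doubled to make its length even, as \<open>no_pumping\<close>
    requires.\<close>
  let ?w = "\<lambda>i. u @ concat (replicate i (v @ v)) @ z"
  have "\<exists>k. 2 * V k = wval V (?w i) \<and> length (?w i) = k + 2" for i
  proof -
    have loop': "foldl (trans M) (foldl (trans M) (init M) u) (concat (replicate i (v @ v)))
          = foldl (trans M) (init M) u"
        "foldl step (foldl step 0 u) (concat (replicate i (v @ v))) = foldl step 0 u"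
      by (intro foldl_concat_replicate; simp add: loop)+
    have same: "foldl (trans M) (init M) (?w i) = foldl (trans M) (init M) w"
        "foldl step 0 (?w i) = foldl step 0 w"
      by (simp_all add: uvz loop loop')
    have gr: "greedy_rep V (wval V (?w i)) (?w i)"
      using w same(2) by (simp add: greedy_rep_iff greedy_iff_step u uvz)
    \<comment> \<open>\<open>M\<close> reaches the same state on both representations, so the pumped
      value is again some \<open>2 * V k\<close>.\<close>
    have "char_seq ((*) 2 ` range V) !! wval V (?w i) = char_seq ((*) 2 ` range V) !! (2 * V n)"
      unfolding M(2) rep_eqI[OF gr] rep_eqI[OF grw] by (rule arg_cong[OF same(1)])
    then have "wval V (?w i) \<in> (*) 2 ` range V"
      by (auto simp: snth_char_seq split: if_splits)
    then obtain k where k: "wval V (?w i) = 2 * V k" by blast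
    then show ?thesis using double[OF gr[unfolded k]] by metis
  qed
  then show False
    using no_pumping[of u u' "v @ v" z] w(4) \<open>v \<noteq> []\<close> \<open>d = 1\<close> by (auto simp: u uvz)
qed

theorem theorem4p1:
  "\<exists>(U :: nat \<Rightarrow> nat) (A :: nat set) (B :: nat set) (x :: nat stream) (l :: nat) (\<mu> :: nat \<Rightarrow> nat list).
     Parry_numeration_system U \<and>
     finite A \<and> finite B \<and>
     x \<in> streams A \<and> automatic U A x \<and>
     l \<ge> 1 \<and> (\<forall>a\<in>A. \<mu> a \<in> lists B \<and> length (\<mu> a) = l) \<and>
     \<not> automatic U B (subst_image \<mu> x)"
proof (intro exI conjI)
  show "Parry_numeration_system V" by (rule Parry_numeration_system_V)
  show "char_seq (range V) \<in> streams {0, 1}" by (simp add: streams_iff_snth snth_char_seq)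
  show "automatic V {0, 1} (char_seq (range V))" by (rule automatic_char_range_V)
  show "\<not> automatic V {0, 1} (subst_image (\<lambda>a. [a, 0]) (char_seq (range V)))"
    unfolding subst_image_char_double by (rule not_automatic_double_V)
  show "\<forall>a\<in>{0, 1}. [a, 0] \<in> lists {0, 1 :: nat} \<and> length [a, 0] = 2" by auto
qed auto

end
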